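(* Consider the formation control system \[ \dot p_i=\sum_{j\in\mathcal{N}_i}(p_j-p_i)\big(\|p_j-p_i\|^2-d_{ij}^2\big)+\sum_{j\in\mathcal{N}_i^o}\Big((p_j-p_i)-(\hat p_j-\hat p_i)\Big),\quad i=1,\dots,n, \] equivalently $\dot p=-R(p)^Te(p)-(L_o\otimes I_d)\bar p$. Suppose the target formation is infinitesimally rigid and the initial positions of all agents are chosen such that the initial formation is sufficiently close to the desired (target) formation. Then the solution converges to the desired equilibrium set \[ \mathcal{M}=\{p\in\mathbb{R}^{dn}:\ e(p)=0,\ p_i-p_j=\hat p_i-\hat p_j\ \ \forall (i,j)\in\mathcal{E}_o\}, \] i.e. to the correct formation shape and orientation, and this convergence is (locally) exponentially fast.
   Context: Let $d\in\{2,3\}$, $n\ge2$ agents with positions $p_i\in\mathbb{R}^d$ (single integrators), $p\in\mathbb{R}^{dn}$ stacked. $\mathcal{G}=(\mathcal{V},\mathcal{E})$ is an undirected graph on $\{1,\dots,n\}$ with $m$ edges, $\mathcal{N}_i=\{j:(i,j)\in\mathcal{E}\}$; each edge $k$ is given an arbitrary orientation (head $j$, tail $i$) and $H\in\mathbb{R}^{m\times n}$ is the incidence matrix ($h_{ki}=1$ if edge $k$ sinks at $i$, $-1$ if it leaves $i$, $0$ otherwise). $z=(H\otimes I_d)p$, $z_k=p_j-p_i$, $Z(z)=\mathrm{diag}(z_1,\dots,z_m)$ block diagonal, rigidity matrix $R(p)=Z(z)^T(H\otimes I_d)$; a framework $(\mathcal{G},p)$ is infinitesimally rigid iff $\mathrm{rank}\,R(p)=dn-d(d+1)/2$.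 Each edge $k=(i,j)$ has desired distance $d_k=d_{ij}>0$ and error $e_k=\|p_i-p_j\|^2-d_k^2$, $e=[e_1,\dots,e_m]^T$. Orientation edges $\mathcal{E}_o\subseteq\mathcal{E}$ define the graph $\mathcal{G}_o=(\mathcal{V},\mathcal{E}_o)$ with neighbor sets $\mathcal{N}_i^o$ and Laplacian $L_o$; for $(i,j)\in\mathcal{E}_o$ a desired relative vector $\hat p_j-\hat p_i$ with $\|\hat p_j-\hat p_i\|=d_{ij}$ is given; $\bar p_i=p_i-\hat p_i$ if $i$ is incident to an edge of $\mathcal{E}_o$ and $\bar p_i=0$ otherwise. The orientation edges are selected as follows: all edges of $\mathcal{E}_o$ are incident to a common agent $i_0$; if $d=2$, $\mathcal{E}_o\neq\emptyset$; if $d=3$, $\mathcal{E}_o$ contains two edges $(i_0,j),(i_0,j')$ whose desired vectors $\hat p_j-\hat p_{i_0},\hat p_{j'}-\hat p_{i_0}$ are linearly independent. A target formation is a point $\tilde p\in\mathcal{M}$, i.e. satisfying all distance constraints $\|\tilde p_i-\tilde p_j\|=d_{ij}$, $(i,j)\in\mathcal{E}$, and all orientation constraints $\tilde p_i-\tilde p_j=\hat p_i-\hat p_j$, $(i,j)\in\mathcal{E}_o$. *)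

theory Defs
  imports "HOL-Analysis.Analysis"
begin

text \<open>Agents are indexed by a finite type 'n, space coordinates by a finite type 'd.
  A configuration p is an element of (real^'d)^'n, i.e. of R^{dn} with the Euclidean norm.
  The undirected graph is a symmetric irreflexive relation E on agents; the desired
  distances are dd i j.\<close>

text \<open>Rigidity matrix R(p) = Z(z)^T (H \<otimes> I_d): one row per ordered pair in E
  (each undirected edge appears with both orientations, which does not change the rank;
  rows of non-edges are zero), columns indexed by (agent, coordinate).  For row (i,j)
  (tail i, head j) the row is z^T in the block of j and -z^T in the block of i, z = p_j - p_i.\<close>
definition rigidity_matrix ::
  "('n::finite \<times> 'n) set \<Rightarrow> (real^'d::finite)^'n \<Rightarrow> real^('n \<times> 'd)^('n \<times> 'n)" where
  "rigidity_matrix E p =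
     (\<chi> e c. if e \<in> E then
        (p$(snd e) - p$(fst e))$(snd c) *
          ((if fst c = snd e then 1 else 0) - (if fst c = fst e then 1 else 0))
      else 0)"

definition infinitesimally_rigid ::
  "('n::finite \<times> 'n) set \<Rightarrow> (real^'d::finite)^'n \<Rightarrow> bool" where
  "infinitesimally_rigid E p \<longleftrightarrow>
     rank (rigidity_matrix E p) = CARD('d) * CARD('n) - CARD('d) * (CARD('d) + 1) div 2"

definition dist_error :: "(real^'d::finite)^'n::finite \<Rightarrow> ('n \<Rightarrow> 'n \<Rightarrow> real) \<Rightarrow> 'n \<Rightarrow> 'n \<Rightarrow> real" where
  "dist_error p dd i j = (norm (p$i - p$j))\<^sup>2 - (dd i j)\<^sup>2"

definition formation_field ::
  "('n::finite \<times> 'n) set \<Rightarrow> ('n \<times> 'n) set \<Rightarrow> ('n \<Rightarrow> 'n \<Rightarrow> real) \<Rightarrow> (real^'d::finite)^'n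
     \<Rightarrow> (real^'d)^'n \<Rightarrow> (real^'d)^'n" where
  "formation_field E Eo dd ph p =
     (\<chi> i. (\<Sum>j\<in>{j. (i,j) \<in> E}. ((norm (p$j - p$i))\<^sup>2 - (dd i j)\<^sup>2) *\<^sub>R (p$j - p$i))
          + (\<Sum>j\<in>{j. (i,j) \<in> Eo}. (p$j - p$i) - (ph$j - ph$i)))"

definition target_set ::
  "('n::finite \<times> 'n) set \<Rightarrow> ('n \<times> 'n) set \<Rightarrow> ('n \<Rightarrow> 'n \<Rightarrow> real) \<Rightarrow> (real^'d::finite)^'n
     \<Rightarrow> ((real^'d)^'n) set" where
  "target_set E Eo dd ph =
     {p. (\<forall>(i,j)\<in>E. dist_error p dd i j = 0) \<and> (\<forall>(i,j)\<in>Eo. p$i - p$j = ph$i - ph$j)}"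

end

theory Submission
  imports Defs
begin

text \<open>The field \<open>F\<close> is a negative gradient, invariant under the space \<open>T\<close> of translations and
  orthogonal to it. Infinitesimal rigidity leaves only translations and rotations in the kernel of
  the rigidity matrix, and the orientation edges exclude the rotations, so the Hessian at the target
  \<open>pt\<close> is positive definite on the orthogonal complement of \<open>T\<close>. Hence
  \<open>y \<bullet> F (pt + y) \<le> - lam * (norm y)\<^sup>2\<close> for small \<open>y\<close> orthogonal to \<open>T\<close>. Along a solution the
  component \<open>c\<close> of \<open>x - pt\<close> in \<open>T\<close> is constant, and \<open>y = x - pt - c\<close> decays exponentially. Near
  \<open>pt\<close> the target set is the orbit \<open>pt + T\<close>, so \<open>norm y\<close> controls the distance to it.\<close>

section \<open>Globally Lipschitz differential equations\<close>

text \<open>Boundedness of \<open>G\<close> makes the Picard integrals grow at most linearly, so an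
  exponential weight turns them into bounded functions and the Banach fixed point theorem applies.
  Its use below is for a field composed with the projection onto a ball.\<close>

lemma lipschitz_ode_global_solution:
  fixes G :: "'a::banach \<Rightarrow> 'a"
  assumes lip: "L-lipschitz_on UNIV G" and bdd: "bounded (range G)"
  shows "\<exists>x. x 0 = p0 \<and> (\<forall>t\<ge>0. (x has_vector_derivative G (x t)) (at t within {0..}))"
proof -
  obtain B where B: "\<And>x. norm (G x) \<le> B"
    using bdd by (auto simp: bounded_iff)
  have L0: "L \<ge> 0"
    using lip lipschitz_on_nonneg by blast
  have B0: "B \<ge> 0"
    using B[of p0] norm_ge_zero order_trans by blast
  \<comment> \<open>Any weight above \<open>L\<close> gives a contraction factor
    \<open>L / K < 1\<close>; the summand 1 also yields \<open>K \<ge> 1\<close>, hence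
    \<open>s \<le> exp (K * s)\<close>.\<close>
  define K where "K = L + 1"
  have K1: "K \<ge> 1"
    using L0 by (simp add: K_def)
  have contG: "continuous_on UNIV G"
    using lip by (rule lipschitz_on_continuous_on)
  \<comment> \<open>With the unknown \<open>u\<close> in \<open>x t = p0 + exp (K * t) *\<^sub>R u t\<close>, the Picard operator contracts
    the sup norm on the whole half line, so no gluing of local solutions is needed.\<close>
  define g where "g u s = G (p0 + exp (K * s) *\<^sub>R apply_bcontfun u s)" for u :: "real \<Rightarrow>\<^sub>C 'a" and s
  have contg: "continuous_on S (g u)" for S u
    unfolding g_def
    by (intro continuous_on_compose2[OF contG] continuous_intros) auto
  define I where "I u t = integral {0..t} (g u)" for u t
  have I_deriv: "(I u has_vector_derivative g u t) (at t within {0..})" if "t \<ge> 0" for u t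
  proof -
    \<comment> \<open>The fundamental theorem is used on a compact interval; its endpoint
      \<open>t + 1\<close> lies beyond \<open>t\<close>, so both within-filters at \<open>t\<close>
      agree.\<close>
    have "(I u has_vector_derivative g u t) (at t within {0..t+1})"
      unfolding I_def using that by (intro integral_has_vector_derivative contg) auto
    moreover have "at t within {0..} = at t within {0..t+1}"
      by (rule at_within_nhd[of _ "{..<t+1}"]) (use that in auto)
    ultimately show ?thesis by simp
  qed
  have contI: "continuous_on {0..} (I u)" for u
    unfolding continuous_on_eq_continuous_within
    using I_deriv has_vector_derivative_continuous by fastforce
  have I_bound: "norm (I u t) \<le> B * t" if "t \<ge> 0" for u t
    using integral_bound[OF that contg, of u B] B by (simp add: I_def g_def)
  \<comment> \<open>Elements of \<open>bcontfun\<close> live on the whole line, so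
    \<open>max 0 t\<close> continues the function to negative times by its value 0 at time
    0.\<close>
  define \<Phi> where "\<Phi> u t = exp (- K * max 0 t) *\<^sub>R I u (max 0 t)" for u and t :: real
  have Phi_in: "\<Phi> u \<in> bcontfun" for u
  proof (rule bcontfun_normI)
    show "continuous_on UNIV (\<Phi> u)"
      unfolding \<Phi>_def
      by (intro continuous_intros continuous_on_compose2[OF contI]) auto
    fix t :: real
    define s where "s = max 0 t"
    have s: "s \<ge> 0" by (simp add: s_def)
    have "s \<le> exp (K * s)"
    proof -
      have "s \<le> K * s" using K1 s by (simp add: mult_le_cancel_right1)
      also have "\<dots> \<le> exp (K * s)" using exp_ge_add_one_self[of "K * s"] by linarith
      finally show ?thesis .
    qed
    then have "exp (- K * s) * s \<le> 1"
      by (simp add: exp_minus field_simps)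
    then have "B * (exp (- K * s) * s) \<le> B"
      using B0 mult_left_le by blast
    moreover have "norm (\<Phi> u t) \<le> exp (- K * s) * (B * s)"
      unfolding \<Phi>_def s_def[symmetric] using I_bound[OF s] by simp
    ultimately show "norm (\<Phi> u t) \<le> B"
      by (simp add: mult_ac)
  qed
  define \<Psi> where "\<Psi> u = Bcontfun (\<Phi> u)" for u
  have Psi_apply: "apply_bcontfun (\<Psi> u) = \<Phi> u" for u
    unfolding \<Psi>_def by (rule Bcontfun_inverse[OF Phi_in])
  have I_diff: "norm (I u t - I v t) \<le> L / K * dist u v * exp (K * t)" if t: "t \<ge> 0" for u v t
  proof -
    \<comment> \<open>Integrating this exponential bound from 0 to \<open>t\<close> produces the
      factor \<open>1 / K\<close>, the source of the contraction.\<close>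
    let ?h = "\<lambda>s. L * dist u v * exp (K * s)"
    have int: "(?h has_integral L * dist u v / K * exp (K * t) - L * dist u v / K * exp (K * 0)) {0..t}"
      using t K1 by (intro fundamental_theorem_of_calculus)
        (auto intro!: derivative_eq_intros simp flip: has_real_derivative_iff_has_vector_derivative)
    have "I u t - I v t = integral {0..t} (\<lambda>s. g u s - g v s)"
      unfolding I_def by (intro integral_diff[symmetric] integrable_continuous_real contg)
    also have "norm \<dots> \<le> integral {0..t} ?h"
    proof (rule integral_norm_bound_integral)
      show "(\<lambda>s. g u s - g v s) integrable_on {0..t}"
        by (intro integrable_continuous_real continuous_intros contg)
      show "?h integrable_on {0..t}"
        using int by blast
      fix s
      have "norm (g u s - g v s) \<le> L * (exp (K * s) * dist (apply_bcontfun u s) (apply_bcontfun v s))"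
        using lipschitz_onD[OF lip, of "p0 + exp (K * s) *\<^sub>R apply_bcontfun u s" "p0 + exp (K * s) *\<^sub>R apply_bcontfun v s"]
        by (simp add: g_def dist_norm flip: scaleR_diff_right)
      also have "\<dots> \<le> L * (exp (K * s) * dist u v)"
        using L0 by (intro mult_left_mono dist_bounded) auto
      finally show "norm (g u s - g v s) \<le> ?h s"
        by (simp add: mult_ac)
    qed
    also have "\<dots> = L * dist u v / K * exp (K * t) - L * dist u v / K * exp (K * 0)"
      using int by (rule integral_unique)
    also have "\<dots> \<le> L * dist u v / K * exp (K * t)"
      using L0 K1 by simp
    finally show ?thesis
      by simp
  qed
  have contr: "dist (\<Psi> u) (\<Psi> v) \<le> L / K * dist u v" for u v
  proof (rule dist_bound)
    fix t :: real
    define s where "s = max 0 t"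
    have s: "s \<ge> 0" by (simp add: s_def)
    have "dist (\<Phi> u t) (\<Phi> v t) = exp (- K * s) * norm (I u s - I v s)"
      unfolding \<Phi>_def s_def[symmetric] dist_norm by (simp flip: scaleR_diff_right)
    also have "\<dots> \<le> exp (- K * s) * (L / K * dist u v * exp (K * s))"
      using I_diff[OF s] by (intro mult_left_mono) auto
    also have "\<dots> = L / K * dist u v"
      by (simp add: exp_minus)
    finally show "dist (apply_bcontfun (\<Psi> u) t) (apply_bcontfun (\<Psi> v) t) \<le> L / K * dist u v"
      by (simp add: Psi_apply)
  qed
  have "0 \<le> L / K" "L / K < 1"
    using L0 by (auto simp: K_def)
  then obtain u where u: "\<Psi> u = u"
    using banach_fix_type[of "L / K" \<Psi>] contr by blast
  have u_eq: "exp (K * t) *\<^sub>R apply_bcontfun u t = I u t" if "t \<ge> 0" for t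
  proof -
    have "apply_bcontfun u t = exp (- K * t) *\<^sub>R I u t"
      using Psi_apply[of u] that by (simp add: u \<Phi>_def)
    then show ?thesis
      by (simp add: exp_minus)
  qed
  let ?x = "\<lambda>t. p0 + I u t"
  have "?x 0 = p0"
    by (simp add: I_def)
  moreover have "(?x has_vector_derivative G (?x t)) (at t within {0..})" if "t \<ge> 0" for t
  proof -
    have "(?x has_vector_derivative 0 + g u t) (at t within {0..})"
      using that by (intro derivative_intros I_deriv)
    moreover have "g u t = G (?x t)"
      by (simp add: g_def u_eq that)
    ultimately show ?thesis by simp
  qed
  ultimately show ?thesis
    by (intro exI[of _ ?x] conjI allI impI)
qed

text \<open>While \<open>h\<close> stays below \<open>\<rho>\<close>, the product
  \<open>h t * exp (lam * t)\<close> cannot increase. At a first time with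
  \<open>h t \<ge> \<rho>\<close> this would give \<open>h t \<le> h 0 < \<rho>\<close>, so the
  barrier is never reached.\<close>

lemma trapped_exponential_decay:
  fixes h :: "real \<Rightarrow> real"
  assumes deriv: "\<And>t. t \<ge> 0 \<Longrightarrow> (h has_real_derivative h' t) (at t within {0..})"
    and decr: "\<And>t. t \<ge> 0 \<Longrightarrow> h t < \<rho> \<Longrightarrow> h' t \<le> - lam * h t"
    and h0: "0 \<le> h 0" "h 0 < \<rho>" and lam: "lam > 0" and t: "t \<ge> 0"
  shows "h t < \<rho> \<and> h t \<le> h 0 * exp (- lam * t)"
proof -
  have cont: "continuous_on {0..} h"
    unfolding continuous_on_eq_continuous_within using deriv DERIV_continuous by fastforce
  \<comment> \<open>The barrier condition is asked for on the open interval only, so that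
    \<open>decay\<close> applies at the first exit time itself.\<close>
  have decay: "h b \<le> h 0 * exp (- lam * b)" if b: "b \<ge> 0" and lt: "\<And>s. 0 < s \<Longrightarrow> s < b \<Longrightarrow> h s < \<rho>" for b
  proof -
    have "h b * exp (lam * b) \<le> h 0 * exp (lam * 0)"
    proof (rule DERIV_nonpos_imp_decreasing_open[OF b])
      fix s assume s: "0 < s" "s < b"
      have "at s within {0..} = at s"
        using s by (intro at_within_interior) auto
      then have "(h has_real_derivative h' s) (at s)"
        using deriv[of s] s by simp
      then have "((\<lambda>s. h s * exp (lam * s)) has_real_derivative (h' s + lam * h s) * exp (lam * s)) (at s)"
        by (auto intro!: derivative_eq_intros simp: algebra_simps)
      moreover have "(h' s + lam * h s) * exp (lam * s) \<le> 0"
        using decr[of s] lt[of s] s by (intro mult_nonpos_nonneg) auto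
      ultimately show "\<exists>y. DERIV (\<lambda>s. h s * exp (lam * s)) s :> y \<and> y \<le> 0" by blast
    next
      show "continuous_on {0..b} (\<lambda>s. h s * exp (lam * s))"
        by (intro continuous_intros continuous_on_subset[OF cont]) auto
    qed
    then show ?thesis
      by (simp add: exp_minus field_simps)
  qed
  have trap: "h s < \<rho>" if "s \<ge> 0" for s
  proof (rule ccontr)
    assume "\<not> h s < \<rho>"
    define S where "S = {0..} \<inter> h -` {\<rho>..}"
    have S: "closed S" "S \<noteq> {}" "bdd_below S"
      using \<open>\<not> h s < \<rho>\<close> that continuous_on_closed_vimage[of "{0..}" h] cont
      by (auto simp: S_def Int_commute intro!: bdd_belowI[of _ 0])
    define b where "b = Inf S"
    have bS: "b \<in> S"
      unfolding b_def using S by (intro closed_contains_Inf)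
    have "h r < \<rho>" if "0 < r" "r < b" for r
      using that cInf_lower[OF _ S(3), of r] by (force simp: b_def S_def)
    then have "h b \<le> h 0 * exp (- lam * b)"
      using bS by (intro decay) (auto simp: S_def)
    also have "\<dots> \<le> h 0"
      using bS h0 lam by (intro mult_left_le) (auto simp: S_def)
    finally show False
      using bS h0 by (auto simp: S_def)
  qed
  show ?thesis
    using trap[OF t] decay[OF t] trap by auto
qed

section \<open>Exponential stability modulo a subspace\<close>

definition ode_solution :: "('a::real_normed_vector \<Rightarrow> 'a) \<Rightarrow> (real \<Rightarrow> 'a) \<Rightarrow> bool" where
  "ode_solution F x \<longleftrightarrow> (\<forall>t\<ge>0. (x has_vector_derivative F (x t)) (at t within {0..}))"

text \<open>Since \<open>F\<close> is orthogonal to \<open>T\<close>, the offset of the solution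
  from \<open>q\<close> stays orthogonal to \<open>T\<close>. Hence \<open>decr\<close> is available
  as long as the offset is shorter than \<open>r\<close>, and the trapping argument shows that it
  always is.\<close>

lemma exponential_decay_modulo_subspace:
  fixes F :: "'a::real_inner \<Rightarrow> 'a"
  assumes orth: "\<And>p w. w \<in> T \<Longrightarrow> F p \<bullet> w = 0"
    and decr: "\<And>y. norm y < r \<Longrightarrow> (\<And>w. w \<in> T \<Longrightarrow> y \<bullet> w = 0) \<Longrightarrow> y \<bullet> F (q + y) \<le> - lam * (norm y)\<^sup>2"
    and lam: "lam > 0" and r: "r > 0"
    and y0: "norm y0 < r" "\<And>w. w \<in> T \<Longrightarrow> y0 \<bullet> w = 0"
    and x0: "x 0 = q + y0"
    and sol: "ode_solution F x" and t: "t \<ge> 0"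
  shows "norm (x t - q) < r \<and> norm (x t - q) \<le> norm y0 * exp (- lam * t)"
proof -
  define y where "y t = x t - q" for t
  have y_0: "y 0 = y0"
    using x0 by (simp add: y_def)
  have y_deriv: "(y has_vector_derivative F (x t)) (at t within {0..})" if "t \<ge> 0" for t
    using sol that unfolding y_def ode_solution_def by (auto intro!: derivative_eq_intros)
  have y_orth: "y t \<bullet> w = 0" if "t \<ge> 0" "w \<in> T" for t w
  proof -
    have "((\<lambda>t. y t \<bullet> w) has_vector_derivative 0) (at s within {0..t})" if "s \<in> {0..t}" for s
    proof -
      have "((\<lambda>t. y t \<bullet> w) has_vector_derivative F (x s) \<bullet> w) (at s within {0..})"
        using that by (intro bounded_linear.has_vector_derivative[OF bounded_linear_inner_left] y_deriv) auto
      then show ?thesis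
        using orth[OF \<open>w \<in> T\<close>] by (auto intro: has_vector_derivative_within_subset)
    qed
    then obtain c where c: "\<And>s. s \<in> {0..t} \<Longrightarrow> y s \<bullet> w = c"
      using has_vector_derivative_zero_constant[of "{0..t}" "\<lambda>t. y t \<bullet> w"] by auto
    have "y t \<bullet> w = y 0 \<bullet> w"
      using c[of t] c[of 0] that by simp
    then show ?thesis
      using y0(2)[OF that(2)] y_0 by simp
  qed
  \<comment> \<open>The squared norm is differentiable even at 0; it decays at rate
    \<open>2 * lam\<close>, and taking the root brings back \<open>lam\<close>.\<close>
  have "(norm (y t))\<^sup>2 < r\<^sup>2 \<and> (norm (y t))\<^sup>2 \<le> (norm (y 0))\<^sup>2 * exp (- (2 * lam) * t)"
  proof (rule trapped_exponential_decay[where h' = "\<lambda>t. 2 * (y t \<bullet> F (x t))"])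
    fix s :: real assume s: "s \<ge> 0"
    have "((\<lambda>s. y s \<bullet> y s) has_vector_derivative y s \<bullet> F (x s) + F (x s) \<bullet> y s) (at s within {0..})"
      by (rule bounded_bilinear.has_vector_derivative[OF bounded_bilinear_inner y_deriv[OF s] y_deriv[OF s]])
    then show "((\<lambda>s. (norm (y s))\<^sup>2) has_real_derivative 2 * (y s \<bullet> F (x s))) (at s within {0..})"
      by (simp add: power2_norm_eq_inner inner_commute has_real_derivative_iff_has_vector_derivative)
    assume "(norm (y s))\<^sup>2 < r\<^sup>2"
    then have "norm (y s) < r"
      using r by (meson less_eq_real_def power_less_imp_less_base)
    then have "y s \<bullet> F (q + y s) \<le> - lam * (norm (y s))\<^sup>2"
      by (intro decr y_orth s)
    then show "2 * (y s \<bullet> F (x s)) \<le> - (2 * lam) * (norm (y s))\<^sup>2"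
      by (simp add: y_def)
  qed (use y_0 y0 lam t r in \<open>auto intro!: power_strict_mono\<close>)
  moreover have "(exp (- lam * t))\<^sup>2 = exp (- (2 * lam) * t)"
    by (simp add: power2_eq_square flip: exp_add)
  ultimately have "norm (y t) < r" "(norm (y t))\<^sup>2 \<le> (norm y0 * exp (- lam * t))\<^sup>2"
    using r power_less_imp_less_base[of "norm (y t)" 2 r] by (auto simp: y_0 power_mult_distrib)
  then show ?thesis
    unfolding y_def by (auto dest: power2_le_imp_le)
qed

text \<open>Splitting \<open>p0 - q\<close> into \<open>c\<close> in \<open>T\<close> and
  \<open>y0\<close> orthogonal to \<open>T\<close> makes \<open>q + c\<close> the limit point;
  invariance carries the decay estimate from \<open>q\<close> to \<open>q + c\<close>. Both
  \<open>c\<close> and the offset stay shorter than \<open>r\<close>, which explains the radius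
  \<open>2 * r\<close> of the Lipschitz bound. The estimate has factor 1 because
  \<open>norm y0\<close> is at most the distance from \<open>p0\<close> to \<open>M\<close>.\<close>

theorem exponential_stability_modulo_subspace:
  fixes F :: "'a::euclidean_space \<Rightarrow> 'a"
  assumes T: "subspace T"
    and invar: "\<And>p w. w \<in> T \<Longrightarrow> F (p + w) = F p"
    and orth: "\<And>p w. w \<in> T \<Longrightarrow> F p \<bullet> w = 0"
    and decr: "\<And>y. norm y < r \<Longrightarrow> (\<And>w. w \<in> T \<Longrightarrow> y \<bullet> w = 0) \<Longrightarrow> y \<bullet> F (q + y) \<le> - lam * (norm y)\<^sup>2"
    and lam: "lam > 0" and r: "r > 0"
    and lip: "L-lipschitz_on (cball q (2 * r)) F"
    and M1: "\<And>w. w \<in> T \<Longrightarrow> q + w \<in> M" and M2: "\<And>p. p \<in> M \<Longrightarrow> F p = 0"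
    and p0: "norm (p0 - q) < r / 2"
  shows "\<exists>x. x 0 = p0 \<and> ode_solution F x"
    and "\<And>x t. x 0 = p0 \<Longrightarrow> ode_solution F x \<Longrightarrow> t \<ge> 0 \<Longrightarrow>
      infdist (x t) M \<le> infdist p0 M * exp (- lam * t)"
proof -
  have decomp: "\<exists>c y. c \<in> T \<and> (\<forall>w\<in>T. y \<bullet> w = 0) \<and> v = c + y \<and> norm c \<le> norm v \<and> norm y \<le> norm v" for v
  proof -
    obtain c y where cy: "c \<in> span T" "\<And>w. w \<in> span T \<Longrightarrow> orthogonal y w" "v = c + y"
      using orthogonal_subspace_decomp_exists by blast
    have "orthogonal c y"
      using cy by (simp add: orthogonal_commute)
    then have "(norm v)\<^sup>2 = (norm c)\<^sup>2 + (norm y)\<^sup>2"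
      using cy(3) norm_add_Pythagorean by blast
    then have "(norm c)\<^sup>2 \<le> (norm v)\<^sup>2" "(norm y)\<^sup>2 \<le> (norm v)\<^sup>2"
      by auto
    then show ?thesis
      using cy T by (metis norm_ge_zero orthogonal_def power2_le_imp_le span_eq_iff)
  qed
  obtain c y0 where c: "c \<in> T" and y0: "\<And>w. w \<in> T \<Longrightarrow> y0 \<bullet> w = 0" and p0_eq: "p0 - q = c + y0"
    and norms: "norm c \<le> norm (p0 - q)" "norm y0 \<le> norm (p0 - q)"
    using decomp[of "p0 - q"] by metis
  have y0_r: "norm y0 < r" and c_r: "norm c < r"
    using norms p0 r by linarith+
  have p0': "p0 = (q + c) + y0"
    using p0_eq by (simp add: algebra_simps)
  have decr': "y \<bullet> F (q + y) \<le> - (lam * (norm y)\<^sup>2)" if "norm y < r" "\<And>w. w \<in> T \<Longrightarrow> y \<bullet> w = 0" for y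
    using decr[OF that] by simp
  have F_c: "F (q + c + y) = F (q + y)" for y
    using invar[OF c, of "q + y"] by (simp add: algebra_simps)
  show ex: "\<exists>x. x 0 = p0 \<and> ode_solution F x"
  proof -
    let ?B = "cball q (2 * r)"
    \<comment> \<open>\<open>G\<close> is globally Lipschitz, and its solution never leaves the region where \<open>G = F\<close>.\<close>
    define G where "G p = F (closest_point ?B p)" for p
    have B: "closed ?B" "convex ?B" "?B \<noteq> {}"
      using r by auto
    have cp: "closest_point ?B p \<in> ?B" for p
      using B by (intro closest_point_in_set) auto
    have "1-lipschitz_on UNIV (closest_point ?B)"
      using closest_point_lipschitz[OF B(2,1,3)] by (intro lipschitz_onI) auto
    moreover have "L-lipschitz_on (closest_point ?B ` UNIV) F"
      using cp by (intro lipschitz_on_subset[OF lip]) auto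
    ultimately have "(L * 1)-lipschitz_on UNIV (F \<circ> closest_point ?B)"
      by (rule lipschitz_on_compose)
    then have lipG: "L-lipschitz_on UNIV G"
      by (simp add: G_def[abs_def] comp_def)
    have "compact (F ` ?B)"
      by (intro compact_continuous_image lipschitz_on_continuous_on[OF lip] compact_cball)
    moreover have "range G \<subseteq> F ` ?B"
      using cp by (auto simp: G_def)
    ultimately have "bounded (range G)"
      using bounded_subset compact_imp_bounded by blast
    with lipG obtain x where x0: "x 0 = p0" and x: "ode_solution G x"
      using lipschitz_ode_global_solution[of L G p0] unfolding ode_solution_def by blast
    have G_eq: "G (q + c + y) = F (q + c + y)" if "norm y < r" for y
    proof -
      have "norm (c + y) \<le> 2 * r"
        using that c_r norm_triangle_ineq[of c y] by linarith
      then have "q + c + y \<in> ?B"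
        unfolding mem_cball dist_commute[of q] by (simp add: dist_norm add.assoc)
      then show ?thesis
        by (simp add: G_def closest_point_self)
    qed
    have G_orth: "G p \<bullet> w = 0" if "w \<in> T" for p w
      using orth[OF that] by (simp add: G_def)
    have "norm (x t - (q + c)) < r" if "t \<ge> 0" for t
    proof -
      have "norm (x t - (q + c)) < r \<and> norm (x t - (q + c)) \<le> norm y0 * exp (- lam * t)"
        using x x0 p0'
        by (intro exponential_decay_modulo_subspace[where F = G and T = T])
          (auto simp: G_orth G_eq F_c lam r y0 y0_r that decr')
      then show ?thesis by blast
    qed
    then have "ode_solution F x"
      using x G_eq[of "x _ - (q + c)"] unfolding ode_solution_def by simp
    with x0 show ?thesis by blast
  qed
  \<comment> \<open>Equilibria within \<open>r\<close> of \<open>q\<close> lie on the orbit \<open>q + T\<close>; all other points of \<open>M\<close> are too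
    far from \<open>p0\<close> to matter.\<close>
  have y0_le: "norm y0 \<le> dist p0 m" if m: "m \<in> M" for m
  proof (cases "norm (m - q) < r")
    case True
    obtain c' y' where c': "c' \<in> T" and y': "\<And>w. w \<in> T \<Longrightarrow> y' \<bullet> w = 0" and m_eq: "m - q = c' + y'"
      and "norm y' \<le> norm (m - q)"
      using decomp[of "m - q"] by metis
    \<comment> \<open>The field vanishes at \<open>m\<close>, hence at \<open>q + y'\<close>, and
      there the decay inequality leaves only \<open>y' = 0\<close>.\<close>
    have "F (q + y') = F m"
      using invar[OF c', of "q + y'"] m_eq by (simp add: algebra_simps)
    then have "0 \<le> - lam * (norm y')\<^sup>2"
      using decr[of y'] y' M2[OF m] True \<open>norm y' \<le> _\<close> by auto
    then have "y' = 0"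
      using lam by (simp add: mult_le_0_iff)
    then have diff: "p0 - m = (c - c') + y0"
      using p0_eq m_eq by (simp add: algebra_simps)
    have "c - c' \<in> T"
      using T c c' by (rule subspace_diff)
    then have "(norm (p0 - m))\<^sup>2 = (norm (c - c'))\<^sup>2 + (norm y0)\<^sup>2"
      unfolding diff by (intro norm_add_Pythagorean) (simp add: orthogonal_def y0 inner_commute)
    then have "(norm y0)\<^sup>2 \<le> (norm (p0 - m))\<^sup>2"
      by simp
    then show ?thesis
      by (simp add: dist_norm)
  next
    case False
    have "norm (m - q) \<le> norm (m - p0) + norm (p0 - q)"
      using norm_triangle_ineq[of "m - p0" "p0 - q"] by simp
    then show ?thesis
      using False p0 norms by (simp add: dist_norm norm_minus_commute)
  qed
  have "M \<noteq> {}"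
    using M1 c by blast
  then have y0_inf: "norm y0 \<le> infdist p0 M"
    using y0_le by (auto simp: infdist_notempty intro!: cINF_greatest)
  fix x and t :: real
  assume "x 0 = p0" "ode_solution F x" and t: "t \<ge> 0"
  then have "norm (x t - (q + c)) < r \<and> norm (x t - (q + c)) \<le> norm y0 * exp (- lam * t)"
    using p0' by (intro exponential_decay_modulo_subspace[where F = F and T = T])
      (auto simp: orth F_c lam r y0 y0_r decr')
  then have "dist (x t) (q + c) \<le> norm y0 * exp (- lam * t)"
    by (simp add: dist_norm)
  also have "\<dots> \<le> infdist p0 M * exp (- lam * t)"
    using y0_inf by simp
  finally show "infdist (x t) M \<le> infdist p0 M * exp (- lam * t)"
    using infdist_le[OF M1[OF c], of "x t"] by linarith
qed

section \<open>Skew-symmetric matrices\<close>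

text \<open>The kernel is the orthogonal complement of the row space, whose dimension is the
  rank.\<close>

lemma dim_nullspace:
  fixes A :: "real^'n^'m"
  shows "dim {x. A *v x = 0} + rank A = CARD('n)"
proof -
  have null: "{x. A *v x = 0} = {x \<in> UNIV. \<forall>y\<in>span (rows A). orthogonal y x}"
  proof -
    have "A *v x = 0" if "\<forall>y\<in>span (rows A). orthogonal y x" for x
    proof -
      have "(A *v x) $ i = 0" for i
      proof -
        have "row i A \<in> span (rows A)"
          by (intro span_base) (auto simp: rows_def)
        then have "orthogonal (row i A) x"
          using that by blast
        then show ?thesis
          by (simp add: orthogonal_def row_def vec_lambda_eta matrix_vector_mul_component)
      qed
      then show ?thesis by (simp add: vec_eq_iff)
    qed
    then show ?thesis
      using orthogonal_nullspace_rowspace[of A] by (auto simp: orthogonal_commute)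
  qed
  show ?thesis
    using dim_subspace_orthogonal_to_vectors[of "span (rows A)" UNIV]
    unfolding null row_rank_def by simp
qed

text \<open>The Lie algebra of the rotation group: \<open>A *v u\<close> is the velocity at
  \<open>u\<close> of an infinitesimal rotation about the origin.\<close>

definition skew_matrices :: "(real^'d^'d) set" where
  "skew_matrices = {A. transpose A = - A}"

lemma skew_matrices_iff: "A \<in> skew_matrices \<longleftrightarrow> (\<forall>i j. A $ i $ j + A $ j $ i = 0)"
  unfolding skew_matrices_def transpose_def vec_eq_iff
  by (simp add: eq_neg_iff_add_eq_0) (metis add.commute)

lemma subspace_skew_matrices: "subspace (skew_matrices :: (real^'d^'d) set)"
proof (rule subspaceI)
  fix A B :: "real^'d^'d" and c :: real
  assume A: "A \<in> skew_matrices"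
  show "c *\<^sub>R A \<in> skew_matrices"
    using A unfolding skew_matrices_iff by (simp flip: distrib_left)
  assume "B \<in> skew_matrices"
  then have "(A + B) $ i $ j + (A + B) $ j $ i = 0" for i j
  proof -
    have "A $ i $ j + A $ j $ i = 0" "B $ i $ j + B $ j $ i = 0"
      using A \<open>B \<in> _\<close> unfolding skew_matrices_iff by blast+
    then show ?thesis by simp
  qed
  then show "A + B \<in> skew_matrices"
    unfolding skew_matrices_iff by blast
qed (simp add: skew_matrices_iff)

lemma skew_inner:
  fixes A :: "real^'d^'d"
  assumes "A \<in> skew_matrices"
  shows "x \<bullet> (A *v y) = - ((A *v x) \<bullet> y)"
proof -
  have "x \<bullet> (A *v y) = (transpose A *v x) \<bullet> y"
    by (simp add: dot_lmul_matrix)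
  also have "transpose A *v x = - (A *v x)"
    using assms by (simp add: skew_matrices_def matrix_vector_mult_def vec_eq_iff sum_negf)
  finally show ?thesis by simp
qed

text \<open>A skew matrix of rank at most 1 vanishes: its range is a line spanned by an eigenvector
  \<open>A *v x\<close>, skewness forces the eigenvalue 0, and applied once more it forces
  \<open>A *v x = 0\<close>. Hence no nonzero infinitesimal rotation annihilates a
  hyperplane.\<close>

lemma skew_eq_0_of_codim_1:
  fixes A :: "real^'d^'d"
  assumes A: "A \<in> skew_matrices" and U: "\<And>u. u \<in> U \<Longrightarrow> A *v u = 0" "CARD('d) \<le> dim U + 1"
  shows "A = 0"
proof (rule ccontr)
  assume "A \<noteq> 0"
  let ?N = "{x. A *v x = 0}"
  have rank: "rank A \<noteq> 0"
    using \<open>A \<noteq> 0\<close> by (simp add: rank_eq_0)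
  have "dim U \<le> dim ?N"
    using U by (intro dim_subset) auto
  then have "rank A \<le> 1"
    using dim_nullspace[of A] U(2) by linarith
  obtain x where x: "A *v x \<noteq> 0"
    using \<open>A \<noteq> 0\<close> by (metis matrix_eq matrix_vector_mult_0)
  let ?w = "A *v x"
  have "dim (range ((*v) A)) \<le> dim (span {?w})"
    using \<open>rank A \<le> 1\<close> x by (simp add: rank_dim_range dim_singleton)
  then have "span {?w} = range ((*v) A)"
  proof (intro subspace_dim_equal)
    show "subspace (range ((*v) A))"
      by (intro linear_subspace_image subspace_UNIV) auto
    then show "span {?w} \<subseteq> range ((*v) A)"
      by (intro span_minimal) auto
  qed auto
  then obtain c where c: "A *v ?w = c *\<^sub>R ?w"
    by (force simp: span_singleton)
  have "c * (?w \<bullet> ?w) = 0"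
    using skew_inner[OF A, of ?w ?w] c by (simp add: inner_commute)
  then have "A *v ?w = 0"
    using x c by simp
  then have "?w \<bullet> ?w = 0"
    using skew_inner[OF A, of x ?w] by simp
  then show False using x by simp
qed

text \<open>The elementary skew matrices with entries 1 at \<open>(i, j)\<close> and -1 at
  \<open>(j, i)\<close>, one for each unordered pair of distinct indices, are nonzero and pairwise
  orthogonal.\<close>

lemma dim_skew_matrices_ge:
  "CARD('d) * (CARD('d) - 1) div 2 \<le> dim (skew_matrices :: (real^'d::finite^'d) set)"
proof -
  \<comment> \<open>The index type carries no order, so an injection into the naturals decides which
    of \<open>(i, j)\<close> and \<open>(j, i)\<close> belongs to \<open>P\<close>.\<close>
  obtain f :: "'d \<Rightarrow> nat" where f: "inj f"
    using finite_imp_inj_to_nat_seg[of "UNIV :: 'd set"] by auto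
  define P where "P = {(i, j). f i < f j}"
  define M :: "'d \<times> 'd \<Rightarrow> real^'d^'d" where
    "M = (\<lambda>(i, j). \<chi> k l. if (k, l) = (i, j) then 1 else if (l, k) = (i, j) then - 1 else 0)"
  have M_nth: "M a $ k $ l = (if (k, l) = a then 1 else if (l, k) = a then - 1 else 0)" for a k l
    by (cases a) (simp add: M_def)
  have skew: "M a \<in> skew_matrices" if "a \<in> P" for a
    using that by (auto simp: skew_matrices_iff M_nth P_def)
  have inj: "inj_on M P"
  proof (rule inj_onI)
    fix a b assume ab: "a \<in> P" "b \<in> P" "M a = M b"
    then have "M a $ fst b $ snd b = 1"
      by (simp add: M_nth)
    then show "a = b"
      by (auto simp: M_nth split: if_splits)
  qed
  have M_orth: "M a \<bullet> M b = 0" if "a \<in> P" "b \<in> P" "a \<noteq> b" for a b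
    unfolding inner_vec_def using that
    by (intro sum.neutral ballI) (auto simp: M_nth P_def)
  have "independent (M ` P)"
  proof (rule pairwise_orthogonal_independent)
    show "pairwise orthogonal (M ` P)"
      using M_orth by (auto simp: pairwise_def orthogonal_def)
    have "M a $ fst a $ snd a \<noteq> 0" for a
      by (simp add: M_nth)
    then show "0 \<notin> M ` P"
      by (metis (no_types, lifting) imageE zero_index)
  qed
  then have "card (M ` P) \<le> dim (skew_matrices :: (real^'d^'d) set)"
    using skew by (intro independent_card_le_dim) auto
  moreover have "card (M ` P) = card P"
    by (rule card_image[OF inj])
  moreover have "card P * 2 = CARD('d) * (CARD('d) - 1)"
  proof -
    have "(UNIV :: ('d \<times> 'd) set) = P \<union> P\<inverse> \<union> Id"
      using f by (auto simp: P_def inj_eq)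
        (metis f injD linorder_neqE_nat)
    moreover have "P \<inter> P\<inverse> = {}" "(P \<union> P\<inverse>) \<inter> Id = {}"
      by (auto simp: P_def)
    ultimately have "CARD('d \<times> 'd) = card P + card (P\<inverse>) + card (Id :: ('d \<times> 'd) set)"
      by (metis card_Un_disjoint finite)
    moreover have "card (Id :: ('d \<times> 'd) set) = CARD('d)"
      using card_image[of "\<lambda>x::'d. (x, x)" UNIV] by (simp add: inj_on_def image_def Id_def)
    ultimately show ?thesis
      by (simp add: card_inverse diff_mult_distrib2)
  qed
  ultimately show ?thesis
    by simp
qed

section \<open>Infinitesimal rigidity\<close>

definition uniform_translations :: "((real^'d)^'n) set" where
  "uniform_translations = range (\<lambda>c. \<chi> i. c)"

lemma linear_translation: "linear (\<lambda>c :: real^'d. (\<chi> i. c) :: (real^'d)^'n)"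
  by (rule linearI) (simp_all add: vec_eq_iff)

lemma subspace_uniform_translations: "subspace (uniform_translations :: ((real^'d)^'n) set)"
  unfolding uniform_translations_def by (intro linear_subspace_image linear_translation subspace_UNIV)

lemma dim_uniform_translations: "dim (uniform_translations :: ((real^'d)^'n) set) = CARD('d)"
proof -
  have "dim (uniform_translations :: ((real^'d)^'n) set) = dim (UNIV :: (real^'d) set)"
    unfolding uniform_translations_def
    by (intro dim_image_eq linear_translation) (auto simp: inj_on_def vec_eq_iff)
  then show ?thesis by simp
qed

text \<open>The kernel of the rigidity matrix, read as a space of velocities: all edge lengths are
  stationary to first order.\<close>

definition infinitesimal_motions ::
  "('n::finite \<times> 'n) set \<Rightarrow> (real^'d::finite)^'n \<Rightarrow> ((real^'d)^'n) set" where
  "infinitesimal_motions E p = {v. \<forall>(i, j)\<in>E. (p $ j - p $ i) \<bullet> (v $ j - v $ i) = 0}"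

lemma subspace_infinitesimal_motions:
  fixes p :: "(real^'d)^'n"
  shows "subspace (infinitesimal_motions E p)"
proof -
  have *: "infinitesimal_motions E p =
      (\<Inter>(i, j)\<in>E. {v. (p $ j - p $ i) \<bullet> (v $ j - v $ i) = 0})"
    by (auto simp: infinitesimal_motions_def)
  have "linear (\<lambda>v :: (real^'d)^'n. (p $ j - p $ i) \<bullet> (v $ j - v $ i))" for i j
    by (rule linearI) (simp_all add: inner_diff_right inner_add_right algebra_simps)
  then show ?thesis
    unfolding * by (auto intro!: subspace_Inter linear_subspace_kernel)
qed

text \<open>Connects configurations, which are vectors of vectors, with the columns of the matrix,
  which are indexed by pairs of an agent and a coordinate.\<close>

lemma rigidity_matrix_mult:
  fixes p v :: "(real^'d)^'n"
  shows "(rigidity_matrix E p *v (\<chi> c. v $ fst c $ snd c)) $ (i, j) =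
    (if (i, j) \<in> E then (p $ j - p $ i) \<bullet> (v $ j - v $ i) else 0)"
proof (cases "(i, j) \<in> E")
  case True
  have delta: "(\<Sum>a\<in>UNIV. x a * (if a = b then 1 else 0)) = x b" for x :: "'n \<Rightarrow> real" and b
    by (simp add: if_distrib cong: if_cong)
  let ?z = "\<lambda>k. p $ j $ k - p $ i $ k"
  have "(rigidity_matrix E p *v (\<chi> c. v $ fst c $ snd c)) $ (i, j) =
      (\<Sum>a\<in>UNIV. \<Sum>k\<in>UNIV. ?z k * ((if a = j then 1 else 0) - (if a = i then 1 else 0)) * v $ a $ k)"
    using True
    by (simp add: matrix_vector_mult_def rigidity_matrix_def sum.cartesian_product case_prod_unfold
        flip: UNIV_Times_UNIV)
  \<comment> \<open>With the agents in the inner sum, the two Kronecker deltas select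
    \<open>j\<close> and \<open>i\<close>.\<close>
  also have "\<dots> = (\<Sum>k\<in>UNIV. \<Sum>a\<in>UNIV. ?z k * v $ a $ k * (if a = j then 1 else 0) - ?z k * v $ a $ k * (if a = i then 1 else 0))"
    by (subst sum.swap) (simp add: algebra_simps)
  also have "\<dots> = (\<Sum>k\<in>UNIV. ?z k * v $ j $ k - ?z k * v $ i $ k)"
    unfolding sum_subtractf delta ..
  also have "\<dots> = (p $ j - p $ i) \<bullet> (v $ j - v $ i)"
    by (simp add: inner_vec_def algebra_simps)
  finally show ?thesis using True by simp
qed (simp add: matrix_vector_mult_def rigidity_matrix_def)

text \<open>Rank-nullity after flattening the configurations. The assumption \<open>n\<close>
  ensures that the subtraction of naturals in \<open>infinitesimally_rigid\<close> is not
  truncated.\<close>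

lemma dim_infinitesimal_motions_le:
  fixes p :: "(real^'d)^'n"
  assumes "infinitesimally_rigid E p" and n: "CARD('d) * (CARD('d) + 1) div 2 \<le> CARD('d) * CARD('n)"
  shows "dim (infinitesimal_motions E p) \<le> CARD('d) * (CARD('d) + 1) div 2"
proof -
  let ?flat = "\<lambda>v :: (real^'d)^'n. \<chi> c. v $ fst c $ snd c"
  have "linear ?flat"
    by (rule linearI) (simp_all add: vec_eq_iff)
  moreover have "inj ?flat"
    by (rule injI) (auto simp: vec_eq_iff)
  ultimately have "dim (infinitesimal_motions E p) = dim (?flat ` infinitesimal_motions E p)"
    by (intro dim_image_eq[symmetric]) (auto intro: inj_on_subset)
  also have "\<dots> \<le> dim {x. rigidity_matrix E p *v x = 0}"
    by (intro dim_subset) (auto simp: infinitesimal_motions_def vec_eq_iff rigidity_matrix_mult)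
  also have "\<dots> + rank (rigidity_matrix E p) = CARD('n) * CARD('d)"
    using dim_nullspace[of "rigidity_matrix E p"] by simp
  finally show ?thesis
    using assms by (simp add: infinitesimally_rigid_def mult.commute)
qed

text \<open>The rotations about agent \<open>i0\<close> form a space of dimension at least \<open>d (d - 1) / 2\<close> that meets
  the motions preserving the oriented edges only in 0, so by rigidity the latter have dimension at
  most \<open>d\<close>.\<close>

lemma orientation_preserving_motion_is_translation:
  fixes p v :: "(real^'d)^'n"
  assumes rigid: "infinitesimally_rigid E p"
    and n: "CARD('d) * (CARD('d) + 1) div 2 \<le> CARD('d) * CARD('n)"
    and codim: "CARD('d) \<le> dim {p $ j - p $ i0 | j. (i0, j) \<in> Eo} + 1"
    and v: "v \<in> infinitesimal_motions E p" "\<And>i j. (i, j) \<in> Eo \<Longrightarrow> v $ i = v $ j"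
  shows "v \<in> uniform_translations"
proof -
  let ?K = "infinitesimal_motions E p"
  define S where "S = ?K \<inter> {v. \<forall>(i, j)\<in>Eo. v $ i = v $ j}"
  define rot where "rot A = (\<chi> i. A *v (p $ i - p $ i0))" for A :: "real^'d^'d"
  define R where "R = rot ` skew_matrices"
  have S: "subspace S"
    unfolding S_def
    by (intro subspace_inter subspace_infinitesimal_motions) (auto simp: subspace_def split_beta)
  have rot: "linear rot"
    by (rule linearI)
      (simp_all add: rot_def vec_eq_iff matrix_vector_mult_add_rdistrib scaleR_matrix_vector_assoc)
  have R: "subspace R"
    unfolding R_def by (intro linear_subspace_image rot subspace_skew_matrices)
  have rot_diff: "rot A $ j - rot A $ i = A *v (p $ j - p $ i)" for A i j
    by (simp add: rot_def flip: matrix_vector_mult_diff_distrib)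
  \<comment> \<open>For an oriented edge at \<open>i0\<close>, equal velocities of its ends mean
    that \<open>A\<close> annihilates the edge vector; by \<open>codim\<close> these vectors span at
    least a hyperplane.\<close>
  have rot_inj: "A = 0" if "A \<in> skew_matrices" "\<And>i j. (i, j) \<in> Eo \<Longrightarrow> rot A $ i = rot A $ j" for A
  proof (rule skew_eq_0_of_codim_1[OF that(1) _ codim])
    fix u assume "u \<in> {p $ j - p $ i0 | j. (i0, j) \<in> Eo}"
    then obtain j where "u = p $ j - p $ i0" "(i0, j) \<in> Eo" by blast
    then show "A *v u = 0"
      using rot_diff[of A j i0] that(2)[of i0 j] by simp
  qed
  have "R \<subseteq> ?K"
  proof -
    have "u \<bullet> (A *v u) = 0" if "A \<in> skew_matrices" for A u
      using skew_inner[OF that, of u u] by (simp add: inner_commute)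
    then show ?thesis
      by (auto simp: R_def infinitesimal_motions_def rot_diff)
  qed
  moreover have "S \<subseteq> ?K"
    by (simp add: S_def)
  ultimately have "{x + y | x y. x \<in> S \<and> y \<in> R} \<subseteq> ?K"
    using subspace_add[OF subspace_infinitesimal_motions] by blast
  then have "dim {x + y | x y. x \<in> S \<and> y \<in> R} \<le> CARD('d) * (CARD('d) + 1) div 2"
    using dim_infinitesimal_motions_le[OF rigid n] dim_subset order_trans by blast
  moreover have "S \<inter> R = {0}"
  proof -
    have "x = 0" if x: "x \<in> S" "x \<in> R" for x
    proof -
      obtain A where A: "A \<in> skew_matrices" "x = rot A"
        using x(2) by (auto simp: R_def)
      then have "A = 0"
        using x(1) by (intro rot_inj) (auto simp: S_def)
      then show ?thesis
        using A(2) linear_0[OF rot] by simp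
    qed
    then show ?thesis
      using subspace_0[OF S] subspace_0[OF R] by auto
  qed
  then have "dim {x + y | x y. x \<in> S \<and> y \<in> R} = dim S + dim R"
    using dim_sums_Int[OF S R] by simp
  moreover have "dim R = dim (skew_matrices :: (real^'d^'d) set)"
    unfolding R_def
  proof (intro dim_image_eq rot)
    have "inj_on rot skew_matrices"
      using rot_inj linear_injective_on_subspace_0[OF rot subspace_skew_matrices]
      by (auto simp: vec_eq_iff)
    then show "inj_on rot (span skew_matrices)"
      using subspace_skew_matrices span_eq_iff by metis
  qed
  moreover have "CARD('d) * (CARD('d) + 1) div 2 = CARD('d) * (CARD('d) - 1) div 2 + CARD('d)"
  proof -
    have "CARD('d) * (CARD('d) + 1) = CARD('d) * (CARD('d) - 1) + CARD('d) * 2"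
      by (cases "CARD('d)") (auto simp: algebra_simps)
    then show ?thesis by simp
  qed
  \<comment> \<open>The sum of \<open>S\<close> and \<open>R\<close> is direct and has dimension at
    most \<open>d (d + 1) / 2\<close>; subtracting at least \<open>d (d - 1) / 2\<close> for
    \<open>R\<close> leaves at most \<open>d\<close> for \<open>S\<close>, which the translations
    already fill.\<close>
  ultimately have "dim S \<le> dim (uniform_translations :: ((real^'d)^'n) set)"
    using dim_skew_matrices_ge[where 'd = 'd] by (simp add: dim_uniform_translations)
  moreover have "uniform_translations \<subseteq> S"
    by (auto simp: uniform_translations_def S_def infinitesimal_motions_def)
  ultimately have "uniform_translations = S"
    using S subspace_uniform_translations by (intro subspace_dim_equal)
  then show ?thesis
    using v by (auto simp: S_def)
qed

section \<open>The formation field\<close>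

text \<open>Summation by parts on the graph. Each undirected edge occurs in both orientations, and
  averaging the two gives the factor 1/2.\<close>

lemma sum_inner_antisymmetric:
  fixes w :: "'n::finite \<Rightarrow> 'n \<Rightarrow> 'a::real_inner" and y :: "'a^'n"
  assumes S: "sym S" and w: "\<And>i j. (i, j) \<in> S \<Longrightarrow> w j i = - w i j"
  shows "(\<Sum>i\<in>UNIV. y $ i \<bullet> (\<Sum>j\<in>{j. (i, j) \<in> S}. w i j)) =
    - (\<Sum>(i, j)\<in>S. (y $ j - y $ i) \<bullet> w i j) / 2"
proof -
  have S_eq: "S = Sigma UNIV (\<lambda>i. {j. (i, j) \<in> S})"
    by auto
  have 1: "(\<Sum>i\<in>UNIV. y $ i \<bullet> (\<Sum>j\<in>{j. (i, j) \<in> S}. w i j)) = (\<Sum>(i, j)\<in>S. y $ i \<bullet> w i j)"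
    by (subst (2) S_eq) (simp add: sum.Sigma inner_sum_right)
  have "(\<Sum>(i, j)\<in>S. y $ i \<bullet> w i j) = (\<Sum>(i, j)\<in>S. y $ j \<bullet> w j i)"
    by (rule sum.reindex_bij_witness[of _ prod.swap prod.swap]) (use S in \<open>auto dest: symD\<close>)
  also have "\<dots> = (\<Sum>(i, j)\<in>S. - (y $ j \<bullet> w i j))"
    by (rule sum.cong) (auto simp: w)
  finally have 2: "(\<Sum>(i, j)\<in>S. y $ i \<bullet> w i j) = (\<Sum>(i, j)\<in>S. - (y $ j \<bullet> w i j))" .
  have "(\<Sum>(i, j)\<in>S. (y $ j - y $ i) \<bullet> w i j) =
      - (\<Sum>(i, j)\<in>S. - (y $ j \<bullet> w i j)) - (\<Sum>(i, j)\<in>S. y $ i \<bullet> w i j)"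
    by (simp add: inner_diff_left sum_subtractf sum_negf case_prod_unfold)
  then show ?thesis
    unfolding 1 using 2 by simp
qed

text \<open>The right-hand side is minus the derivative along \<open>y\<close> of the potential
  consisting of one eighth of the sum over \<open>E\<close> of the squared distance errors and one
  quarter of the sum over \<open>Eo\<close> of the squared orientation errors.\<close>

lemma inner_formation_field:
  fixes p y :: "(real^'d)^'n"
  assumes "sym E" "sym Eo" and dd: "\<forall>(i, j)\<in>E. dd i j = dd j i"
  shows "y \<bullet> formation_field E Eo dd ph p =
    - (\<Sum>(i, j)\<in>E. ((norm (p $ j - p $ i))\<^sup>2 - (dd i j)\<^sup>2) * ((y $ j - y $ i) \<bullet> (p $ j - p $ i))) / 2
    - (\<Sum>(i, j)\<in>Eo. (y $ j - y $ i) \<bullet> ((p $ j - p $ i) - (ph $ j - ph $ i))) / 2"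
proof -
  let ?w = "\<lambda>i j. ((norm (p $ j - p $ i))\<^sup>2 - (dd i j)\<^sup>2) *\<^sub>R (p $ j - p $ i)"
  let ?wo = "\<lambda>i j. (p $ j - p $ i) - (ph $ j - ph $ i)"
  have "?w j i = - ?w i j" if "(i, j) \<in> E" for i j
    using bspec[OF dd that] by (simp add: norm_minus_commute[of "p $ i"] flip: scaleR_minus_right)
  then have "(\<Sum>i\<in>UNIV. y $ i \<bullet> (\<Sum>j\<in>{j. (i, j) \<in> E}. ?w i j)) =
      - (\<Sum>(i, j)\<in>E. (y $ j - y $ i) \<bullet> ?w i j) / 2"
    using \<open>sym E\<close> by (intro sum_inner_antisymmetric)
  moreover have "(\<Sum>i\<in>UNIV. y $ i \<bullet> (\<Sum>j\<in>{j. (i, j) \<in> Eo}. ?wo i j)) =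
      - (\<Sum>(i, j)\<in>Eo. (y $ j - y $ i) \<bullet> ?wo i j) / 2"
    using \<open>sym Eo\<close> by (intro sum_inner_antisymmetric) auto
  ultimately show ?thesis
    by (simp only: formation_field_def inner_vec_def[of y] vec_lambda_beta inner_add_right sum.distrib
        inner_scaleR_right)
qed

lemma formation_field_translate:
  "w \<in> uniform_translations \<Longrightarrow> formation_field E Eo dd ph (p + w) = formation_field E Eo dd ph p"
  by (auto simp: uniform_translations_def formation_field_def)

text \<open>All edge differences of a translation vanish. Dynamically, the centroid of the agents is
  conserved.\<close>

lemma formation_field_orthogonal_translations:
  assumes "sym E" "sym Eo" "\<forall>(i, j)\<in>E. dd i j = dd j i" "w \<in> uniform_translations"
  shows "formation_field E Eo dd ph p \<bullet> w = 0"
proof -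
  obtain c where "w = (\<chi> i. c)"
    using assms(4) by (auto simp: uniform_translations_def)
  then show ?thesis
    using inner_formation_field[OF assms(1-3), where y = w and ph = ph and p = p] by (simp add: inner_commute)
qed

lemma formation_field_target_set:
  assumes "p \<in> target_set E Eo dd ph"
  shows "formation_field E Eo dd ph p = 0"
proof -
  have "(norm (p $ j - p $ i))\<^sup>2 - (dd i j)\<^sup>2 = 0" if "(i, j) \<in> E" for i j
    using assms that by (auto simp: target_set_def dist_error_def norm_minus_commute)
  moreover have "p $ j - p $ i - (ph $ j - ph $ i) = 0" if "(i, j) \<in> Eo" for i j
    using assms that by (auto simp: target_set_def algebra_simps)
  ultimately show ?thesis
    by (simp add: formation_field_def vec_eq_iff)
qed

lemma target_set_translate:
  "p \<in> target_set E Eo dd ph \<Longrightarrow> w \<in> uniform_translations \<Longrightarrow> p + w \<in> target_set E Eo dd ph"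
  by (auto simp: uniform_translations_def target_set_def dist_error_def)

section \<open>Lipschitz continuity of the field on bounded sets\<close>

lemma lipschitz_on_scaleR:
  fixes f :: "'a::metric_space \<Rightarrow> real" and g :: "'a \<Rightarrow> 'b::real_normed_vector"
  assumes f: "K-lipschitz_on X f" and g: "L-lipschitz_on X g"
    and A: "\<And>x. x \<in> X \<Longrightarrow> \<bar>f x\<bar> \<le> A" and B: "\<And>x. x \<in> X \<Longrightarrow> norm (g x) \<le> B"
    and nonneg: "0 \<le> A" "0 \<le> B"
  shows "(A * L + B * K)-lipschitz_on X (\<lambda>x. f x *\<^sub>R g x)"
proof (rule lipschitz_onI)
  fix x y assume xy: "x \<in> X" "y \<in> X"
  have "f x *\<^sub>R g x - f y *\<^sub>R g y = f x *\<^sub>R (g x - g y) + (f x - f y) *\<^sub>R g y"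
    by (simp add: algebra_simps)
  also have "norm \<dots> \<le> \<bar>f x\<bar> * norm (g x - g y) + \<bar>f x - f y\<bar> * norm (g y)"
    by (metis norm_scaleR norm_triangle_ineq)
  also have "\<dots> \<le> A * (L * dist x y) + (K * dist x y) * B"
    using lipschitz_onD[OF f xy] lipschitz_onD[OF g xy] A B xy nonneg lipschitz_on_nonneg[OF f]
    by (intro add_mono mult_mono) (auto simp: dist_norm)
  finally show "dist (f x *\<^sub>R g x) (f y *\<^sub>R g y) \<le> (A * L + B * K) * dist x y"
    by (simp add: dist_norm algebra_simps)
qed (use lipschitz_on_nonneg[OF f] lipschitz_on_nonneg[OF g] nonneg in auto)

lemma lipschitz_on_sum_ex:
  fixes f :: "'i \<Rightarrow> 'a::metric_space \<Rightarrow> 'b::real_normed_vector"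
  assumes "\<And>i. i \<in> I \<Longrightarrow> \<exists>L. L-lipschitz_on X (f i)"
  shows "\<exists>L. L-lipschitz_on X (\<lambda>x. \<Sum>i\<in>I. f i x)"
proof (cases "finite I")
  case True
  then show ?thesis
    using assms
  proof (induction I)
    case empty
    then show ?case using lipschitz_on_constant[of X 0] by auto
  next
    case (insert i I)
    then obtain K L where "K-lipschitz_on X (f i)" "L-lipschitz_on X (\<lambda>x. \<Sum>i\<in>I. f i x)"
      by (meson insertCI)
    then show ?case
      using insert.hyps lipschitz_on_add by (simp, blast)
  qed
next
  case False
  then show ?thesis using lipschitz_on_constant[of X 0] by auto
qed

lemma lipschitz_on_vec_ex:
  fixes f :: "'a::metric_space \<Rightarrow> 'b::real_normed_vector^'n"
  assumes "\<And>i. \<exists>L. L-lipschitz_on X (\<lambda>x. f x $ i)"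
  shows "\<exists>L. L-lipschitz_on X f"
proof -
  obtain L where L: "\<And>i. (L i)-lipschitz_on X (\<lambda>x. f x $ i)"
    using assms by metis
  have "(\<Sum>i\<in>UNIV. L i)-lipschitz_on X f"
  proof (rule lipschitz_onI)
    fix x y assume xy: "x \<in> X" "y \<in> X"
    have "dist (f x) (f y) \<le> (\<Sum>i\<in>UNIV. dist (f x $ i) (f y $ i))"
      unfolding dist_vec_def by (intro L2_set_le_sum) auto
    also have "\<dots> \<le> (\<Sum>i\<in>UNIV. L i * dist x y)"
      using lipschitz_onD[OF L xy] by (intro sum_mono)
    finally show "dist (f x) (f y) \<le> (\<Sum>i\<in>UNIV. L i) * dist x y"
      by (simp add: sum_distrib_right)
  qed (use lipschitz_on_nonneg[OF L] in \<open>auto intro: sum_nonneg\<close>)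
  then show ?thesis by blast
qed

lemma norm_component_diff_le:
  fixes p :: "'a::real_normed_vector^'n"
  shows "norm (p $ j - p $ i) \<le> 2 * norm p"
  using norm_triangle_ineq4[of "p $ j" "p $ i"] Finite_Cartesian_Product.norm_nth_le[of p i]
    Finite_Cartesian_Product.norm_nth_le[of p j] by linarith

lemma formation_field_lipschitz:
  fixes X :: "((real^'d)^'n) set"
  assumes "bounded X"
  shows "\<exists>L. L-lipschitz_on X (formation_field E Eo dd ph)"
proof -
  obtain B where B: "\<And>p. p \<in> X \<Longrightarrow> norm p \<le> B" and B0: "0 \<le> B"
    using assms unfolding bounded_pos by (meson less_imp_le)
  have diff: "2-lipschitz_on X (\<lambda>p. p $ j - p $ i)" for i j
  proof (rule lipschitz_onI)
    fix p q :: "(real^'d)^'n"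
    have "(p $ j - p $ i) - (q $ j - q $ i) = (p - q) $ j - (p - q) $ i"
      by simp
    then show "dist (p $ j - p $ i) (q $ j - q $ i) \<le> 2 * dist p q"
      unfolding dist_norm using norm_component_diff_le[of "p - q"] by metis
  qed simp
  have bound: "norm (p $ j - p $ i) \<le> 2 * B" if "p \<in> X" for p i j
    using norm_component_diff_le[of p j i] B[OF that] by linarith
  have norm_lip: "2-lipschitz_on X (\<lambda>p. norm (p $ j - p $ i))" for i j
    using lipschitz_onD[OF diff, of _ _ j i]
    by (intro lipschitz_onI) (auto simp: dist_norm intro: order_trans[OF norm_triangle_ineq3])
  \<comment> \<open>The square is treated as a product of two real factors, each 2-Lipschitz and
    bounded by \<open>2 * B\<close>.\<close>
  have "(2 * B * 2 + 2 * B * 2)-lipschitz_on X (\<lambda>p. norm (p $ j - p $ i) *\<^sub>R norm (p $ j - p $ i))" for i j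
    using bound B0 by (intro lipschitz_on_scaleR norm_lip) auto
  then have sq: "(2 * B * 2 + 2 * B * 2 + 0)-lipschitz_on X (\<lambda>p. (norm (p $ j - p $ i))\<^sup>2 - c)" for i j c
    unfolding power2_eq_square real_scaleR_def by (intro lipschitz_on_diff lipschitz_on_constant) simp
  have dist_term: "\<exists>L. L-lipschitz_on X (\<lambda>p. ((norm (p $ j - p $ i))\<^sup>2 - c) *\<^sub>R (p $ j - p $ i))" for i j c
  proof -
    have "\<bar>(norm (p $ j - p $ i))\<^sup>2 - c\<bar> \<le> (2 * B)\<^sup>2 + \<bar>c\<bar>" if "p \<in> X" for p
      using power_mono[OF bound[OF that, of j i] norm_ge_zero, of 2]
        zero_le_power2[of "norm (p $ j - p $ i)"] by linarith
    then have "(((2 * B)\<^sup>2 + \<bar>c\<bar>) * 2 + 2 * B * (2 * B * 2 + 2 * B * 2 + 0))-lipschitz_on X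
        (\<lambda>p. ((norm (p $ j - p $ i))\<^sup>2 - c) *\<^sub>R (p $ j - p $ i))"
      using bound B0 by (intro lipschitz_on_scaleR sq diff) auto
    then show ?thesis
      by blast
  qed
  have orient_term: "\<exists>L. L-lipschitz_on X (\<lambda>p. (p $ j - p $ i) - (ph $ j - ph $ i))" for i j
    using lipschitz_on_diff[OF diff lipschitz_on_constant] by blast
  have "\<exists>L. L-lipschitz_on X (\<lambda>p. formation_field E Eo dd ph p $ i)" for i
  proof -
    have "\<exists>K. K-lipschitz_on X (\<lambda>p. \<Sum>j\<in>{j. (i,j) \<in> E}. ((norm (p$j - p$i))\<^sup>2 - (dd i j)\<^sup>2) *\<^sub>R (p$j - p$i))"
      "\<exists>L. L-lipschitz_on X (\<lambda>p. \<Sum>j\<in>{j. (i,j) \<in> Eo}. (p$j - p$i) - (ph$j - ph$i))"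
      by (intro lipschitz_on_sum_ex dist_term orient_term)+
    then obtain K L where
      "K-lipschitz_on X (\<lambda>p. \<Sum>j\<in>{j. (i,j) \<in> E}. ((norm (p$j - p$i))\<^sup>2 - (dd i j)\<^sup>2) *\<^sub>R (p$j - p$i))"
      "L-lipschitz_on X (\<lambda>p. \<Sum>j\<in>{j. (i,j) \<in> Eo}. (p$j - p$i) - (ph$j - ph$i))"
      by blast
    then have "(K + L)-lipschitz_on X (\<lambda>p. formation_field E Eo dd ph p $ i)"
      unfolding formation_field_def vec_lambda_beta by (rule lipschitz_on_add)
    then show ?thesis
      by blast
  qed
  then show ?thesis
    by (rule lipschitz_on_vec_ex)
qed

section \<open>Coercivity of the Hessian modulo translations\<close>

lemma positive_quadratic_lower_bound:
  fixes Q :: "'a::euclidean_space \<Rightarrow> real"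
  assumes cont: "continuous_on UNIV Q" and hom: "\<And>c y. Q (c *\<^sub>R y) = c\<^sup>2 * Q y"
    and S: "subspace S" and pos: "\<And>y. y \<in> S \<Longrightarrow> y \<noteq> 0 \<Longrightarrow> Q y > 0"
  shows "\<exists>\<mu>>0. \<forall>y\<in>S. \<mu> * (norm y)\<^sup>2 \<le> Q y"
\<comment> \<open>For the zero subspace there is no unit vector to minimise over, and any constant
  works; otherwise the minimum of \<open>Q\<close> on the compact unit sphere of \<open>S\<close>
  serves as \<open>\<mu>\<close>, by homogeneity.\<close>
proof (cases "sphere 0 1 \<inter> S = {}")
  case True
  have "y = 0" if "y \<in> S" for y
  proof (rule ccontr)
    assume "y \<noteq> 0"
    then have "y /\<^sub>R norm y \<in> sphere 0 1 \<inter> S"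
      using that S by (simp add: subspace_scale)
    then show False using True by blast
  qed
  then show ?thesis
    using hom[of 0 0] by (intro exI[of _ 1]) force
next
  case False
  have "compact (sphere 0 1 \<inter> S)"
    using S by (intro compact_Int_closed closed_subspace) auto
  then obtain u where u: "u \<in> sphere 0 1 \<inter> S" "\<And>y. y \<in> sphere 0 1 \<inter> S \<Longrightarrow> Q u \<le> Q y"
    using continuous_attains_inf[OF _ False continuous_on_subset[OF cont]] by auto
  have "Q u * (norm y)\<^sup>2 \<le> Q y" if "y \<in> S" for y
  proof (cases "y = 0")
    case True
    then show ?thesis using hom[of 0 0] by simp
  next
    case False
    then have "Q u \<le> Q (y /\<^sub>R norm y)"
      using that S by (intro u(2)) (simp add: subspace_scale)
    then show ?thesis
      using False by (simp add: hom field_simps)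
  qed
  moreover have "Q u > 0"
    using u(1) by (intro pos) auto
  ultimately show ?thesis by blast
qed

text \<open>Up to the weights of the two sums, this is the Hessian at \<open>p\<close> of the potential whose
  negative gradient is the formation field.\<close>

definition hessian_form ::
  "('n::finite \<times> 'n) set \<Rightarrow> ('n \<times> 'n) set \<Rightarrow> (real^'d::finite)^'n \<Rightarrow> (real^'d)^'n \<Rightarrow> real" where
  "hessian_form E Eo p y = (\<Sum>(i, j)\<in>E. ((p $ j - p $ i) \<bullet> (y $ j - y $ i))\<^sup>2)
     + (\<Sum>(i, j)\<in>Eo. (norm (y $ j - y $ i))\<^sup>2)"

text \<open>A zero of the form is an infinitesimal motion preserving the oriented edges, hence a
  translation by \<open>ker\<close>. If it is also orthogonal to all translations, it is orthogonal
  to itself, so the form is positive definite there.\<close>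

lemma hessian_form_lower_bound:
  fixes p :: "(real^'d)^'n"
  assumes ker: "\<And>v. v \<in> infinitesimal_motions E p \<Longrightarrow> (\<And>i j. (i, j) \<in> Eo \<Longrightarrow> v $ i = v $ j)
      \<Longrightarrow> v \<in> uniform_translations"
  shows "\<exists>\<mu>>0. \<forall>y. (\<forall>w\<in>uniform_translations. y \<bullet> w = 0) \<longrightarrow> \<mu> * (norm y)\<^sup>2 \<le> hessian_form E Eo p y"
proof -
  define S where "S = {y :: (real^'d)^'n. \<forall>w\<in>uniform_translations. orthogonal w y}"
  have "\<exists>\<mu>>0. \<forall>y\<in>S. \<mu> * (norm y)\<^sup>2 \<le> hessian_form E Eo p y"
  proof (rule positive_quadratic_lower_bound)
    show "continuous_on UNIV (hessian_form E Eo p)"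
      unfolding hessian_form_def case_prod_unfold by (intro continuous_intros)
    show "hessian_form E Eo p (c *\<^sub>R y) = c\<^sup>2 * hessian_form E Eo p y" for c y
      by (simp add: hessian_form_def power_mult_distrib sum_distrib_left distrib_left case_prod_unfold
          flip: scaleR_diff_right)
    show "subspace S"
      unfolding S_def by (rule subspace_orthogonal_to_vectors)
    fix y assume y: "y \<in> S" "y \<noteq> 0"
    have nonneg: "0 \<le> (\<Sum>(i, j)\<in>E. ((p $ j - p $ i) \<bullet> (y $ j - y $ i))\<^sup>2)"
      "0 \<le> (\<Sum>(i, j)\<in>Eo. (norm (y $ j - y $ i))\<^sup>2)"
      by (auto intro: sum_nonneg)
    show "0 < hessian_form E Eo p y"
    proof (rule ccontr)
      assume "\<not> ?thesis"
      then have 0: "(\<Sum>(i, j)\<in>E. ((p $ j - p $ i) \<bullet> (y $ j - y $ i))\<^sup>2) = 0"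
        "(\<Sum>(i, j)\<in>Eo. (norm (y $ j - y $ i))\<^sup>2) = 0"
        using nonneg by (auto simp: hessian_form_def)
      have "y \<in> uniform_translations"
      proof (rule ker)
        show "y \<in> infinitesimal_motions E p"
          using 0(1) by (subst (asm) sum_nonneg_eq_0_iff) (auto simp: infinitesimal_motions_def)
        show "y $ i = y $ j" if "(i, j) \<in> Eo" for i j
          using 0(2) that by (subst (asm) sum_nonneg_eq_0_iff) auto
      qed
      then show False
        using y by (auto simp: S_def orthogonal_def)
    qed
  qed
  then show ?thesis
    by (auto simp: S_def orthogonal_def inner_commute)
qed

text \<open>At a target the desired lengths are those of \<open>p\<close>, so an edge contributes
  \<open>(2 * a + b) * (a + b)\<close>, where \<open>a\<close> is the inner product of the edge
  differences of \<open>p\<close> and \<open>y\<close>, and \<open>b\<close> is the squared edge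
  difference of \<open>y\<close>. Giving up half of the leading \<open>2 * a^2\<close> absorbs the
  cubic term and leaves an error of fourth order. Oriented edges contribute exactly
  \<open>b\<close>.\<close>

lemma inner_formation_field_le:
  fixes p y :: "(real^'d)^'n"
  assumes "sym E" "sym Eo" and dd: "\<forall>(i, j)\<in>E. dd i j = dd j i"
    and p: "p \<in> target_set E Eo dd ph"
  shows "y \<bullet> formation_field E Eo dd ph (p + y) \<le>
    - hessian_form E Eo p y / 2 + 10 * (real (card E) * (norm y)^4)"
proof -
  let ?a = "\<lambda>i j. (p $ j - p $ i) \<bullet> (y $ j - y $ i)"
  let ?b = "\<lambda>i j. (norm (y $ j - y $ i))\<^sup>2"
  have E_term: "((norm ((p + y) $ j - (p + y) $ i))\<^sup>2 - (dd i j)\<^sup>2) * ((y $ j - y $ i) \<bullet> ((p + y) $ j - (p + y) $ i))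
      \<ge> (?a i j)\<^sup>2 - 20 * (norm y)^4" if "(i, j) \<in> E" for i j
  proof -
    have split: "(p + y) $ j - (p + y) $ i = (p $ j - p $ i) + (y $ j - y $ i)"
      by simp
    have "(dd i j)\<^sup>2 = (norm (p $ j - p $ i))\<^sup>2"
      using p that by (auto simp: target_set_def dist_error_def norm_minus_commute)
    then have "((norm ((p + y) $ j - (p + y) $ i))\<^sup>2 - (dd i j)\<^sup>2) * ((y $ j - y $ i) \<bullet> ((p + y) $ j - (p + y) $ i))
        = (2 * ?a i j + ?b i j) * (?a i j + ?b i j)"
      unfolding split power2_norm_eq_inner by (simp add: inner_add_left inner_add_right inner_commute)
    \<comment> \<open>Completing the square; the constant 20 below is \<open>5 / 4 * 16\<close>, as
      \<open>?b i j\<close> is at most four times the squared norm of \<open>y\<close>.\<close>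
    also have "\<dots> = (?a i j)\<^sup>2 + (?a i j + 3 / 2 * ?b i j)\<^sup>2 - 5 / 4 * (?b i j)\<^sup>2"
      by (simp add: power2_eq_square algebra_simps)
    also have "\<dots> \<ge> (?a i j)\<^sup>2 - 20 * (norm y)^4"
    proof -
      have "?b i j \<le> (2 * norm y)\<^sup>2"
        by (intro power_mono norm_component_diff_le) auto
      then have "(?b i j)\<^sup>2 \<le> ((2 * norm y)\<^sup>2)\<^sup>2"
        by (rule power_mono) (rule zero_le_power2)
      also have "\<dots> = 16 * (norm y)^4"
        by (simp add: power_mult_distrib flip: power_mult)
      finally show ?thesis
        using zero_le_power2[of "?a i j + 3 / 2 * ?b i j"] by linarith
    qed
    finally show ?thesis .
  qed
  have Eo_term: "(y $ j - y $ i) \<bullet> (((p + y) $ j - (p + y) $ i) - (ph $ j - ph $ i)) = ?b i j"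
    if "(i, j) \<in> Eo" for i j
  proof -
    have "p $ i - p $ j = ph $ i - ph $ j"
      using p that by (auto simp: target_set_def)
    then have "((p + y) $ j - (p + y) $ i) - (ph $ j - ph $ i) = y $ j - y $ i"
      by (simp add: algebra_simps)
    then show ?thesis
      by (simp only: power2_norm_eq_inner)
  qed
  have "(\<Sum>(i, j)\<in>E. (?a i j)\<^sup>2) - 20 * (real (card E) * (norm y)^4) = (\<Sum>(i, j)\<in>E. (?a i j)\<^sup>2 - 20 * (norm y)^4)"
    by (simp add: sum_subtractf case_prod_unfold)
  also have "\<dots> \<le> (\<Sum>(i, j)\<in>E. ((norm ((p + y) $ j - (p + y) $ i))\<^sup>2 - (dd i j)\<^sup>2) * ((y $ j - y $ i) \<bullet> ((p + y) $ j - (p + y) $ i)))"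
    using E_term by (intro sum_mono) auto
  finally have E_sum: "(\<Sum>(i, j)\<in>E. (?a i j)\<^sup>2) - 20 * (real (card E) * (norm y)^4) \<le> \<dots>" .
  have Eo_sum: "(\<Sum>(i, j)\<in>Eo. (y $ j - y $ i) \<bullet> (((p + y) $ j - (p + y) $ i) - (ph $ j - ph $ i)))
      = (\<Sum>(i, j)\<in>Eo. ?b i j)"
    by (intro sum.cong refl) (auto simp: Eo_term simp del: vector_add_component)
  \<comment> \<open>The remaining arithmetic is stated for abstract reals, so that the long sums
    enter as atoms; the factor 1/2 turns 20 into 10.\<close>
  have "u = - v / 2 - w / 2 \<Longrightarrow> q - 20 * k \<le> v \<Longrightarrow> w = o' \<Longrightarrow> u \<le> - (q + o') / 2 + 10 * k"
    for u v w q o' k :: real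
    by (simp add: field_simps)
  from this[OF inner_formation_field[OF assms(1,2) dd] E_sum Eo_sum] show ?thesis
    unfolding hessian_form_def .
qed

section \<open>Local exponential convergence to the target set\<close>

theorem theorem3:
  fixes E Eo :: "('n::finite \<times> 'n) set"
    and dd :: "'n \<Rightarrow> 'n \<Rightarrow> real"
    and ph pt :: "(real^'d::finite)^'n"
  assumes n2: "CARD('n) \<ge> 2"
    and d23: "CARD('d) = 2 \<or> CARD('d) = 3"
    and E_sym: "sym E" and E_irrefl: "\<forall>i. (i,i) \<notin> E"
    and Eo_sub: "Eo \<subseteq> E" and Eo_sym: "sym Eo"
    and dd_pos: "\<forall>(i,j)\<in>E. dd i j > 0 \<and> dd i j = dd j i"
    and ph_len: "\<forall>(i,j)\<in>Eo. norm (ph$j - ph$i) = dd i j"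
    and Eo_sel: "\<exists>i0. (\<forall>(i,j)\<in>Eo. i = i0 \<or> j = i0)
        \<and> (CARD('d) = 2 \<longrightarrow> Eo \<noteq> {})
        \<and> (CARD('d) = 3 \<longrightarrow> (\<exists>j j'. (i0,j) \<in> Eo \<and> (i0,j') \<in> Eo
              \<and> ph$j - ph$i0 \<noteq> ph$j' - ph$i0
              \<and> independent {ph$j - ph$i0, ph$j' - ph$i0}))"
    and pt_target: "pt \<in> target_set E Eo dd ph"
    and pt_rigid: "infinitesimally_rigid E pt"
  shows "\<exists>\<delta>>0. \<exists>C>0. \<exists>lam>0. \<forall>p0. norm (p0 - pt) < \<delta> \<longrightarrow>
           (\<exists>x. x 0 = p0 \<and>
              (\<forall>t\<ge>0. (x has_vector_derivative formation_field E Eo dd ph (x t)) (at t within {0..})))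
         \<and> (\<forall>x. x 0 = p0 \<and>
              (\<forall>t\<ge>0. (x has_vector_derivative formation_field E Eo dd ph (x t)) (at t within {0..}))
              \<longrightarrow> (\<forall>t\<ge>0. infdist (x t) (target_set E Eo dd ph)
                        \<le> C * infdist p0 (target_set E Eo dd ph) * exp (- lam * t)))"
proof -
  let ?F = "formation_field E Eo dd ph" and ?M = "target_set E Eo dd ph"
  have dd_sym: "\<forall>(i, j)\<in>E. dd i j = dd j i" and dd_gt_0: "(i, j) \<in> E \<Longrightarrow> dd i j > 0" for i j
    using dd_pos by auto
  have orient: "pt $ j - pt $ i = ph $ j - ph $ i" if "(i, j) \<in> Eo" for i j
    using pt_target that by (auto simp: target_set_def algebra_simps)
  \<comment> \<open>The left side is 3 or 6, and the bound is attained for two agents in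
    space.\<close>
  have card: "CARD('d) * (CARD('d) + 1) div 2 \<le> CARD('d) * CARD('n)"
    using d23 n2 by auto
  obtain i0 where i0: "\<And>i j. (i, j) \<in> Eo \<Longrightarrow> i = i0 \<or> j = i0"
    and sel2: "CARD('d) = 2 \<Longrightarrow> Eo \<noteq> {}"
    and sel3: "CARD('d) = 3 \<Longrightarrow> \<exists>j j'. (i0,j) \<in> Eo \<and> (i0,j') \<in> Eo
              \<and> ph$j - ph$i0 \<noteq> ph$j' - ph$i0 \<and> independent {ph$j - ph$i0, ph$j' - ph$i0}"
    using Eo_sel by blast
  let ?U = "{pt $ j - pt $ i0 | j. (i0, j) \<in> Eo}"
  \<comment> \<open>In the plane one nonzero edge vector suffices; in space the two independent ones
    do. Symmetry of \<open>Eo\<close> allows \<open>i0\<close> to be taken as the tail.\<close>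
  have codim: "CARD('d) \<le> dim ?U + 1"
    using d23
  proof
    assume d2: "CARD('d) = 2"
    then obtain a b where "(a, b) \<in> Eo"
      using sel2 by auto
    then obtain j where j: "(i0, j) \<in> Eo"
      using i0[of a b] Eo_sym by (metis symD)
    have "norm (pt $ j - pt $ i0) > 0"
      using orient[OF j] bspec[OF ph_len j] dd_gt_0[of i0 j] j Eo_sub by auto
    then have "dim ?U \<noteq> 0"
      unfolding dim_eq_0 using j by auto
    then show ?thesis
      using d2 by linarith
  next
    assume d3: "CARD('d) = 3"
    then obtain j j' where j: "(i0,j) \<in> Eo" "(i0,j') \<in> Eo" "ph$j - ph$i0 \<noteq> ph$j' - ph$i0"
      "independent {ph$j - ph$i0, ph$j' - ph$i0}"
      using sel3 by blast
    have "card {ph$j - ph$i0, ph$j' - ph$i0} \<le> dim ?U"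
    proof (rule independent_card_le_dim[OF _ j(4)])
      have "ph$j - ph$i0 \<in> ?U" "ph$j' - ph$i0 \<in> ?U"
        using j(1,2) orient by force+
      then show "{ph$j - ph$i0, ph$j' - ph$i0} \<subseteq> ?U"
        by blast
    qed
    then show ?thesis
      using d3 j(3) by simp
  qed
  have "\<exists>\<mu>>0. \<forall>y. (\<forall>w\<in>uniform_translations. y \<bullet> w = 0) \<longrightarrow> \<mu> * (norm y)\<^sup>2 \<le> hessian_form E Eo pt y"
    by (intro hessian_form_lower_bound orientation_preserving_motion_is_translation[OF pt_rigid card codim])
  then obtain \<mu> where \<mu>: "\<mu> > 0" and coercive:
    "\<And>y. \<forall>w\<in>uniform_translations. y \<bullet> w = 0 \<Longrightarrow> \<mu> * (norm y)\<^sup>2 \<le> hessian_form E Eo pt y"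
    by auto
  \<comment> \<open>The bound 1 gives \<open>(norm y)\<^sup>2 \<le> norm y\<close>; the second bound
    then keeps the quartic error below \<open>\<mu> / 4 * (norm y)\<^sup>2\<close>. Half of the
    Hessian supplies \<open>\<mu> / 2\<close>, so the rate \<open>\<mu> / 4\<close> remains. The
    \<open>+ 1\<close> keeps the denominator positive.\<close>
  define r where "r = min 1 (\<mu> / (40 * (real (card E) + 1)))"
  have r: "r > 0"
    using \<mu> by (simp add: r_def)
  have decr: "y \<bullet> ?F (pt + y) \<le> - (\<mu> / 4) * (norm y)\<^sup>2"
    if y: "norm y < r" "\<And>w. w \<in> uniform_translations \<Longrightarrow> y \<bullet> w = 0" for y
  proof -
    have "(norm y)\<^sup>2 \<le> norm y * 1"
      unfolding power2_eq_square using y(1) by (intro mult_left_mono) (auto simp: r_def)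
    then have "(norm y)\<^sup>2 \<le> \<mu> / (40 * (real (card E) + 1))"
      using y(1) by (simp add: r_def)
    then have "40 * (real (card E) + 1) * (norm y)\<^sup>2 \<le> \<mu>"
      by (simp add: field_simps)
    moreover have "40 * (real (card E) + 1) * (norm y)\<^sup>2 = 40 * (real (card E) * (norm y)\<^sup>2) + 40 * (norm y)\<^sup>2"
      by (simp add: algebra_simps)
    ultimately have "10 * (real (card E) * (norm y)\<^sup>2) \<le> \<mu> / 4"
      using zero_le_power2[of "norm y"] by linarith
    then have "10 * (real (card E) * (norm y)\<^sup>2) * (norm y)\<^sup>2 \<le> \<mu> / 4 * (norm y)\<^sup>2"
      by (intro mult_right_mono) auto
    then have "10 * (real (card E) * (norm y)^4) \<le> \<mu> / 4 * (norm y)\<^sup>2"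
      by (simp add: power2_eq_square power4_eq_xxxx mult.assoc)
    moreover have "\<mu> * (norm y)\<^sup>2 \<le> hessian_form E Eo pt y"
      using y(2) by (intro coercive ballI)
    ultimately show ?thesis
      using inner_formation_field_le[OF E_sym Eo_sym dd_sym pt_target, of y] by simp
  qed
  obtain L where lip: "L-lipschitz_on (cball pt (2 * r)) ?F"
    using formation_field_lipschitz[OF bounded_cball] by blast
  have lam: "\<mu> / 4 > 0"
    using \<mu> by simp
  note T = subspace_uniform_translations
    and invar = formation_field_translate[of _ E Eo dd ph]
    and orth = formation_field_orthogonal_translations[OF E_sym Eo_sym dd_sym, of _ ph]
    and M = target_set_translate[OF pt_target] formation_field_target_set[of _ E Eo dd ph]
  have "\<exists>x. x 0 = p0 \<and> ode_solution ?F x" if p0: "norm (p0 - pt) < r / 2" for p0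
    by (rule exponential_stability_modulo_subspace(1)[OF T invar orth decr lam r lip M p0])
  moreover have "infdist (x t) ?M \<le> infdist (x 0) ?M * exp (- (\<mu> / 4) * t)"
    if p0: "norm (x 0 - pt) < r / 2" and x: "ode_solution ?F x" "t \<ge> 0" for x t
    by (rule exponential_stability_modulo_subspace(2)[OF T invar orth decr lam r lip M p0 refl x])
  \<comment> \<open>The witnesses are \<open>r / 2\<close> for the initial radius, 1 for the factor
    \<open>C\<close>, and \<open>\<mu> / 4\<close> for the rate.\<close>
  ultimately show ?thesis
    unfolding ode_solution_def using r lam
    by (intro exI[of _ "r / 2"] exI[of _ 1] exI[of _ "\<mu> / 4"] conjI allI impI) auto
qed

end
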